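(* Let $B$ be a Banach space, let $(A_n)_{n\in\mathbb{Z}}\in l_\infty(\mathbb{Z},\mathcal{L}(B))$ with every $A_n$ invertible, and let $h=(h_n)_{n\in\mathbb{Z}}\in l_\infty(\mathbb{Z},B)$. Suppose that the homogeneous equation $x_{n+1}=A_nx_n$ is exponentially dichotomous on the semi-axes $\mathbb{Z}_+$ and $\mathbb{Z}_-$ with projectors $P$ and $Q$ respectively, and that the operator $D=P-(I-Q):B\to B$ is generalized invertible, with generalized inverse $D^-$. Put $\mathcal{P}_{N(D)}=I-D^-D$, $\mathcal{P}_{B_D}=I-DD^-$, and $$H(k+1)=\mathcal{P}_{B_D}QU^{-1}(k+1)=\mathcal{P}_{B_D}(I-P)U^{-1}(k+1),\qquad k\in\mathbb{Z}.$$ Then solutions of the equation $$x_{n+1}=A_nx_n+h_n,\qquad n\in\mathbb{Z},$$ bounded on the entire axis $\mathbb{Z}$ exist if and only if $$\sum_{k=-\infty}^{+\infty}H(k+1)h_k=0.$$ If this condition holds, the set of solutions bounded on $\mathbb{Z}$ is $$x_n(c)=U(n)P\mathcal{P}_{N(D)}c+(G[h])(n),\qquad c\in B,$$ where $$(G[h])(n)=\sum_{k=0}^{n-1}U(n)PU^{-1}(k+1)h_k-\sum_{k=n}^{+\infty}U(n)(I-P)U^{-1}(k+1)h_k+U(n)PD^-\Big[\sum_{k=0}^{+\infty}(I-P)U^{-1}(k+1)h_k+\sum_{k=-\infty}^{-1}QU^{-1}(k+1)h_k\Big]$$ for $n\ge 0$, and $$(G[h])(n)=\sum_{k=-\infty}^{n-1}U(n)QU^{-1}(k+1)h_k-\sum_{k=n}^{-1}U(n)(I-Q)U^{-1}(k+1)h_k+U(n)(I-Q)D^-\Big[\sum_{k=0}^{+\infty}(I-P)U^{-1}(k+1)h_k+\sum_{k=-\infty}^{-1}QU^{-1}(k+1)h_k\Big]$$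 for $n\le 0$. Moreover $G$ has the following properties: $$(G[h])(0+0)-(G[h])(0-0)=-\sum_{k=-\infty}^{+\infty}H(k+1)h_k=0,\qquad (LG[h])(n)=h_n,\quad n\in\mathbb{Z},$$ where $(G[h])(0+0)$ and $(G[h])(0-0)$ denote the values at $n=0$ of the first and of the second expression for $G[h]$ respectively.
   Context: $\mathcal{L}(B)$ denotes the bounded linear operators on $B$; $l_\infty(\mathbb{Z},Y)$ denotes the bounded sequences indexed by $\mathbb{Z}$ with values in $Y$, with the sup norm. $\mathbb{Z}_+=\{n\in\mathbb{Z}:n\ge 0\}$, $\mathbb{Z}_-=\{n\in\mathbb{Z}:n\le 0\}$. The operator $L:l_\infty(\mathbb{Z},B)\to l_\infty(\mathbb{Z},B)$ is $(Lx)(n)=x_{n+1}-A_nx_n$. Evolution operator: $U(0)=I$, $U(n)=A_{n-1}A_{n-2}\cdots A_0$ for $n>0$, and $U(n)=A_n^{-1}A_{n+1}^{-1}\cdots A_{-1}^{-1}$ for $n<0$, so that $U(n+1)=A_nU(n)$ for all $n\in\mathbb{Z}$; $U^{-1}(n)$ is the inverse of $U(n)$. Exponential dichotomy on $\mathbb{Z}_+$ and $\mathbb{Z}_-$ with projectors $P$ and $Q$: $P,Q\in\mathcal{L}(B)$ satisfy $P^2=P$, $Q^2=Q$, and there are constants $k_1,k_2\ge 1$ and $0<\lambda_1,\lambda_2<1$ such that for all $m,n\in\mathbb{Z}_+$ $$\|U(n)PU^{-1}(m)\|\le k_1\lambda_1^{n-m}\ (n\ge m),\qquad \|U(n)(I-P)U^{-1}(m)\|\le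 k_1\lambda_1^{m-n}\ (m\ge n),$$ and for all $m,n\in\mathbb{Z}_-$ $$\|U(n)QU^{-1}(m)\|\le k_2\lambda_2^{n-m}\ (n\ge m),\qquad \|U(n)(I-Q)U^{-1}(m)\|\le k_2\lambda_2^{m-n}\ (m\ge n).$$ An operator $D\in\mathcal{L}(B)$ is generalized invertible if there is $D^-\in\mathcal{L}(B)$ with $D^-DD^-=D^-$ and $DD^-D=D$. Then $\mathcal{P}_{N(D)}=I-D^-D$ is a projector onto the kernel $N(D)$, and $\mathcal{P}_{B_D}=I-DD^-$ is a projector onto a complement $B_D$ of the range $R(D)$, $B=B_D\oplus R(D)$. Sums over empty index sets are zero. *)

theory Defs
  imports "HOL-Analysis.Analysis"
begin

definition blinfun_inverses ::
    "('a::real_normed_vector \<Rightarrow>\<^sub>L 'a) \<Rightarrow> ('a \<Rightarrow>\<^sub>L 'a) \<Rightarrow> bool" where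
  "blinfun_inverses S T \<longleftrightarrow> S o\<^sub>L T = id_blinfun \<and> T o\<^sub>L S = id_blinfun"

definition blinfun_invertible :: "('a::real_normed_vector \<Rightarrow>\<^sub>L 'a) \<Rightarrow> bool" where
  "blinfun_invertible S \<longleftrightarrow> (\<exists>T. blinfun_inverses S T)"

(* Meaningful only for invertible arguments, where the inverse is unique. *)
definition blinfun_inverse :: "('a::real_normed_vector \<Rightarrow>\<^sub>L 'a) \<Rightarrow> ('a \<Rightarrow>\<^sub>L 'a)" where
  "blinfun_inverse S = (THE T. blinfun_inverses S T)"

(* evol_fwd A n = A_{n-1} ... A_0 *)
primrec evol_fwd ::
    "(int \<Rightarrow> 'a::real_normed_vector \<Rightarrow>\<^sub>L 'a) \<Rightarrow> nat \<Rightarrow> ('a \<Rightarrow>\<^sub>L 'a)" where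
  "evol_fwd A 0 = id_blinfun"
| "evol_fwd A (Suc n) = A (int n) o\<^sub>L evol_fwd A n"

(* evol_bwd A n = A_{-n}^{-1} A_{-n+1}^{-1} ... A_{-1}^{-1} *)
primrec evol_bwd ::
    "(int \<Rightarrow> 'a::real_normed_vector \<Rightarrow>\<^sub>L 'a) \<Rightarrow> nat \<Rightarrow> ('a \<Rightarrow>\<^sub>L 'a)" where
  "evol_bwd A 0 = id_blinfun"
| "evol_bwd A (Suc n) = blinfun_inverse (A (- int (Suc n))) o\<^sub>L evol_bwd A n"

definition evol :: "(int \<Rightarrow> 'a::real_normed_vector \<Rightarrow>\<^sub>L 'a) \<Rightarrow> int \<Rightarrow> ('a \<Rightarrow>\<^sub>L 'a)" where
  "evol A n = (if 0 \<le> n then evol_fwd A (nat n) else evol_bwd A (nat (- n)))"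

definition evol_inv :: "(int \<Rightarrow> 'a::real_normed_vector \<Rightarrow>\<^sub>L 'a) \<Rightarrow> int \<Rightarrow> ('a \<Rightarrow>\<^sub>L 'a)" where
  "evol_inv A n = blinfun_inverse (evol A n)"

definition exp_dichotomy_on ::
    "int set \<Rightarrow> (int \<Rightarrow> 'a::real_normed_vector \<Rightarrow>\<^sub>L 'a) \<Rightarrow> ('a \<Rightarrow>\<^sub>L 'a) \<Rightarrow> bool" where
  "exp_dichotomy_on J A P \<longleftrightarrow>
     P o\<^sub>L P = P \<and>
     (\<exists>k l :: real. 1 \<le> k \<and> 0 < l \<and> l < 1 \<and>
       (\<forall>m\<in>J. \<forall>n\<in>J. m \<le> n \<longrightarrow>
          norm (evol A n o\<^sub>L P o\<^sub>L evol_inv A m) \<le> k * l powi (n - m)) \<and>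
       (\<forall>m\<in>J. \<forall>n\<in>J. n \<le> m \<longrightarrow>
          norm (evol A n o\<^sub>L (id_blinfun - P) o\<^sub>L evol_inv A m) \<le> k * l powi (m - n)))"

definition generalized_inverse ::
    "('a::real_normed_vector \<Rightarrow>\<^sub>L 'a) \<Rightarrow> ('a \<Rightarrow>\<^sub>L 'a) \<Rightarrow> bool" where
  "generalized_inverse D Dm \<longleftrightarrow> Dm o\<^sub>L D o\<^sub>L Dm = Dm \<and> D o\<^sub>L Dm o\<^sub>L D = D"

definition proj_kernel ::
    "('a::real_normed_vector \<Rightarrow>\<^sub>L 'a) \<Rightarrow> ('a \<Rightarrow>\<^sub>L 'a) \<Rightarrow> ('a \<Rightarrow>\<^sub>L 'a)" where
  "proj_kernel D Dm = id_blinfun - (Dm o\<^sub>L D)"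

definition proj_corange ::
    "('a::real_normed_vector \<Rightarrow>\<^sub>L 'a) \<Rightarrow> ('a \<Rightarrow>\<^sub>L 'a) \<Rightarrow> ('a \<Rightarrow>\<^sub>L 'a)" where
  "proj_corange D Dm = id_blinfun - (D o\<^sub>L Dm)"

definition dich_op ::
    "('a::real_normed_vector \<Rightarrow>\<^sub>L 'a) \<Rightarrow> ('a \<Rightarrow>\<^sub>L 'a) \<Rightarrow> ('a \<Rightarrow>\<^sub>L 'a)" where
  "dich_op P Q = P - (id_blinfun - Q)"

definition H_op ::
    "(int \<Rightarrow> 'a::real_normed_vector \<Rightarrow>\<^sub>L 'a) \<Rightarrow> ('a \<Rightarrow>\<^sub>L 'a) \<Rightarrow> ('a \<Rightarrow>\<^sub>L 'a) \<Rightarrow>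
     ('a \<Rightarrow>\<^sub>L 'a) \<Rightarrow> int \<Rightarrow> ('a \<Rightarrow>\<^sub>L 'a)" where
  "H_op A P Q Dm n = proj_corange (dich_op P Q) Dm o\<^sub>L Q o\<^sub>L evol_inv A n"

definition L_op ::
    "(int \<Rightarrow> 'a::real_normed_vector \<Rightarrow>\<^sub>L 'a) \<Rightarrow> (int \<Rightarrow> 'a) \<Rightarrow> int \<Rightarrow> 'a" where
  "L_op A x n = x (n + 1) - A n (x n)"

definition is_solution ::
    "(int \<Rightarrow> 'a::real_normed_vector \<Rightarrow>\<^sub>L 'a) \<Rightarrow> (int \<Rightarrow> 'a) \<Rightarrow> (int \<Rightarrow> 'a) \<Rightarrow> bool" where
  "is_solution A h x \<longleftrightarrow> (\<forall>n. x (n + 1) = A n (x n) + h n)"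

(* The bracket common to both branches of G. *)
definition G_bracket ::
    "(int \<Rightarrow> 'a::real_normed_vector \<Rightarrow>\<^sub>L 'a) \<Rightarrow> ('a \<Rightarrow>\<^sub>L 'a) \<Rightarrow> ('a \<Rightarrow>\<^sub>L 'a) \<Rightarrow>
     (int \<Rightarrow> 'a) \<Rightarrow> 'a" where
  "G_bracket A P Q h =
     (\<Sum>\<^sub>\<infinity>k\<in>{0..}. ((id_blinfun - P) o\<^sub>L evol_inv A (k + 1)) (h k)) +
     (\<Sum>\<^sub>\<infinity>k\<in>{..-1}. (Q o\<^sub>L evol_inv A (k + 1)) (h k))"

definition G_plus ::
    "(int \<Rightarrow> 'a::real_normed_vector \<Rightarrow>\<^sub>L 'a) \<Rightarrow> ('a \<Rightarrow>\<^sub>L 'a) \<Rightarrow> ('a \<Rightarrow>\<^sub>L 'a) \<Rightarrow>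
     ('a \<Rightarrow>\<^sub>L 'a) \<Rightarrow> (int \<Rightarrow> 'a) \<Rightarrow> int \<Rightarrow> 'a" where
  "G_plus A P Q Dm h n =
     (\<Sum>k\<in>{0..n-1}. (evol A n o\<^sub>L P o\<^sub>L evol_inv A (k + 1)) (h k)) -
     (\<Sum>\<^sub>\<infinity>k\<in>{n..}. (evol A n o\<^sub>L (id_blinfun - P) o\<^sub>L evol_inv A (k + 1)) (h k)) +
     (evol A n o\<^sub>L P o\<^sub>L Dm) (G_bracket A P Q h)"

definition G_minus ::
    "(int \<Rightarrow> 'a::real_normed_vector \<Rightarrow>\<^sub>L 'a) \<Rightarrow> ('a \<Rightarrow>\<^sub>L 'a) \<Rightarrow> ('a \<Rightarrow>\<^sub>L 'a) \<Rightarrow>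
     ('a \<Rightarrow>\<^sub>L 'a) \<Rightarrow> (int \<Rightarrow> 'a) \<Rightarrow> int \<Rightarrow> 'a" where
  "G_minus A P Q Dm h n =
     (\<Sum>\<^sub>\<infinity>k\<in>{..n-1}. (evol A n o\<^sub>L Q o\<^sub>L evol_inv A (k + 1)) (h k)) -
     (\<Sum>k\<in>{n..-1}. (evol A n o\<^sub>L (id_blinfun - Q) o\<^sub>L evol_inv A (k + 1)) (h k)) +
     (evol A n o\<^sub>L (id_blinfun - Q) o\<^sub>L Dm) (G_bracket A P Q h)"

(* Both branches are meant to be valid at n = 0; the choice of G_plus there is harmless
   exactly when G_plus and G_minus agree at 0. *)
definition G_op ::
    "(int \<Rightarrow> 'a::real_normed_vector \<Rightarrow>\<^sub>L 'a) \<Rightarrow> ('a \<Rightarrow>\<^sub>L 'a) \<Rightarrow> ('a \<Rightarrow>\<^sub>L 'a) \<Rightarrow>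
     ('a \<Rightarrow>\<^sub>L 'a) \<Rightarrow> (int \<Rightarrow> 'a) \<Rightarrow> int \<Rightarrow> 'a" where
  "G_op A P Q Dm h n = (if 0 \<le> n then G_plus A P Q Dm h n else G_minus A P Q Dm h n)"

end

theory Submission
  imports Defs
begin

text \<open>
  Write \<open>g k = U\<inverse>(k+1) h\<^sub>k\<close> for the forcing pulled back to time \<open>0\<close> and \<open>S n\<close> for its oriented
  sum from \<open>0\<close> to \<open>n\<close>.  The solutions of the inhomogeneous equation are exactly the sequences
  \<open>x n = U n (v + S n)\<close> with \<open>v = x 0\<close>, so everything reduces to conditions on \<open>v\<close>.

  By the dichotomy, the Green's function sums converge geometrically and are bounded uniformly
  in \<open>n\<close> (\<open>dichotomy_green_bound\<close>).  With \<open>a = \<Sum>k\<ge>0. (I-P) g k\<close> and \<open>b = \<Sum>k<0. Q g k\<close>, these sums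
  equal \<open>U n (S n - a)\<close> for \<open>n \<ge> 0\<close> and \<open>U n (S n + b)\<close> for \<open>n \<le> 0\<close>; these are particular solutions
  bounded on one half-axis each.  A solution of the homogeneous equation is bounded on the
  nonnegative axis iff it starts in the range of \<open>P\<close>, and on the nonpositive axis iff it starts in
  the kernel of \<open>Q\<close>.  Hence \<open>x\<close> is bounded on the two half-axes iff \<open>(I-P) v = -a\<close> and \<open>Q v = b\<close>
  respectively (\<open>forward_bounded_iff\<close>, \<open>backward_bounded_iff\<close>).

  Adding these two conditions gives \<open>D v = a + b\<close>, so \<open>a + b\<close> lies in the range of \<open>D\<close>, that is
  \<open>(I - D D\<^sup>-)(a + b) = 0\<close>.  Because \<open>(I - D D\<^sup>-) D = 0\<close>, the operators \<open>(I - D D\<^sup>-) Q\<close> and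
  \<open>(I - D D\<^sup>-)(I - P)\<close> coincide, and the left-hand side is the series \<open>\<Sum>k. H(k+1) h\<^sub>k\<close>
  (\<open>H_op_has_sum\<close>).  Conversely, with \<open>w = D\<^sup>-(a + b)\<close> the two branches of \<open>G[h]\<close> are
  \<open>U n (P w - a + S n)\<close> and \<open>U n ((I-Q) w + b + S n)\<close>.  Their difference at \<open>0\<close> is
  \<open>D w - (a + b) = - (I - D D\<^sup>-)(a + b)\<close>; when it vanishes they form one solution, whose initial
  value satisfies both conditions.  Two bounded solutions differ by a trajectory starting at
  some \<open>c\<close> with \<open>P c = c\<close> and \<open>Q c = 0\<close>, and the set of such \<open>c\<close> is the image of \<open>N(D)\<close> under \<open>P\<close>.
\<close>

section \<open>Sums dominated by a geometric series\<close>

lemma summable_on_geometric_bound: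
  fixes f :: "'b \<Rightarrow> 'a::banach" and C l :: real and j :: "'b \<Rightarrow> nat"
  assumes l: "0 < l" "l < 1" and C: "0 \<le> C"
    and inj: "inj_on j K"
    and bound: "\<And>k. k \<in> K \<Longrightarrow> norm (f k) \<le> C * l ^ j k"
  shows "f summable_on K" and "norm (infsum f K) \<le> C / (1 - l)"
proof -
  have "(\<lambda>i. l ^ i) sums (1 / (1 - l))"
    using l by (intro geometric_sums) auto
  then have "(\<lambda>i. C * l ^ i) sums (C * (1 / (1 - l)))"
    by (rule sums_mult)
  then have hs: "((\<lambda>i. C * l ^ i) has_sum (C / (1 - l))) UNIV"
    using l C by (intro sums_nonneg_imp_has_sum) auto
  then have sU: "(\<lambda>i. C * l ^ i) summable_on UNIV"
    by (rule has_sum_imp_summable)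
  then have sI: "(\<lambda>i. C * l ^ i) summable_on j ` K"
    by (rule summable_on_subset_banach) auto
  then have sK: "(\<lambda>k. C * l ^ j k) summable_on K"
    using summable_on_reindex[OF inj, of "\<lambda>i. C * l ^ i"] by (simp add: o_def)
  have abs: "(\<lambda>k. norm (f k)) summable_on K"
    by (rule summable_on_comparison_test[OF sK]) (use bound in auto)
  then show "f summable_on K"
    by (rule abs_summable_summable)
  have "norm (infsum f K) \<le> (\<Sum>\<^sub>\<infinity>k\<in>K. norm (f k))"
    using abs by (rule norm_infsum_bound)
  also have "\<dots> \<le> (\<Sum>\<^sub>\<infinity>k\<in>K. C * l ^ j k)"
    by (rule infsum_mono[OF abs sK bound])
  also have "\<dots> = (\<Sum>\<^sub>\<infinity>i\<in>j ` K. C * l ^ i)"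
    using infsum_reindex[OF inj, of "\<lambda>i. C * l ^ i"] by (simp add: o_def)
  also have "\<dots> \<le> (\<Sum>\<^sub>\<infinity>i\<in>UNIV. C * l ^ i)"
    by (rule infsum_mono_neutral[OF sI sU]) (use l C in auto)
  also have "\<dots> = C / (1 - l)"
    using hs by (rule infsumI)
  finally show "norm (infsum f K) \<le> C / (1 - l)" .
qed

lemma infsum_blinfun_apply:
  fixes T :: "'a::banach \<Rightarrow>\<^sub>L 'b::banach"
  assumes "f summable_on K"
  shows "(\<Sum>\<^sub>\<infinity>k\<in>K. T (f k)) = T (infsum f K)"
  by (rule infsumI[OF has_sum_bounded_linear[OF blinfun.bounded_linear_right
        has_sum_infsum[OF assms]]])

lemma summable_on_blinfun_apply:
  fixes T :: "'a::banach \<Rightarrow>\<^sub>L 'b::banach"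
  assumes "f summable_on K"
  shows "(\<lambda>k. T (f k)) summable_on K"
  by (rule summable_on_bounded_linear[OF blinfun.bounded_linear_right assms])

section \<open>The evolution operator\<close>

lemma blinfun_inverses_apply:
  assumes "blinfun_inverses S T"
  shows "S (T v) = v" and "T (S v) = v"
  using assms unfolding blinfun_inverses_def
  by (metis blinfun_apply_blinfun_compose id_blinfun.rep_eq)+

lemma blinfun_inverses_inverse:
  assumes "blinfun_invertible S"
  shows "blinfun_inverses S (blinfun_inverse S)"
proof -
  obtain T where T: "blinfun_inverses S T"
    using assms by (auto simp: blinfun_invertible_def)
  have "R = T" if "blinfun_inverses S R" for R
  proof -
    have "R v = T (S (R v))" for v
      by (simp add: blinfun_inverses_apply[OF T])
    then show ?thesis
      by (auto intro!: blinfun_eqI simp: blinfun_inverses_apply[OF that])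
  qed
  then show ?thesis
    unfolding blinfun_inverse_def using T by (rule theI[rotated])
qed

lemma blinfun_invertibleI:
  fixes S T :: "'a::real_normed_vector \<Rightarrow>\<^sub>L 'a"
  assumes "\<And>v. S (T v) = v" and "\<And>v. T (S v) = v"
  shows "blinfun_invertible S"
  unfolding blinfun_invertible_def blinfun_inverses_def
  using assms by (intro exI[of _ T]) (auto intro!: blinfun_eqI)

lemma evol_0: "evol A 0 = id_blinfun"
  by (simp add: evol_def)

text \<open>The recursion holds for negative times as well, where it undoes one of the inverse factors.\<close>

lemma evol_Suc:
  assumes inv: "\<forall>n. blinfun_invertible (A n)"
  shows "evol A (n + 1) = A n o\<^sub>L evol A n"
proof (cases "0 \<le> n")
  case True
  then have "nat (n + 1) = Suc (nat n)" by simp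
  with True show ?thesis by (simp add: evol_def)
next
  case False
  then have n: "nat (- n) = Suc (nat (- (n + 1)))" by simp
  have eq: "- int (Suc (nat (- (n + 1)))) = n" using False by simp
  have "evol A n = blinfun_inverse (A n) o\<^sub>L evol_bwd A (nat (- (n + 1)))"
    using False unfolding evol_def n evol_bwd.simps eq by simp
  also have "evol_bwd A (nat (- (n + 1))) = evol A (n + 1)"
    using False by (cases "n = -1") (auto simp: evol_def)
  finally have "evol A n = blinfun_inverse (A n) o\<^sub>L evol A (n + 1)" .
  then show ?thesis
    by (auto intro!: blinfun_eqI
        simp: blinfun_inverses_apply[OF blinfun_inverses_inverse[OF inv[rule_format]]])
qed

lemma evol_invertible:
  assumes inv: "\<forall>n. blinfun_invertible (A n)"
  shows "blinfun_invertible (evol A n)"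
proof (induction n rule: int_induct[where k = 0])
  case base
  show ?case by (rule blinfun_invertibleI[of _ id_blinfun]) (simp_all add: evol_0)
next
  case (step1 i)
  show ?case
    by (rule blinfun_invertibleI[of _ "blinfun_inverse (evol A i) o\<^sub>L blinfun_inverse (A i)"])
      (simp_all add: evol_Suc[OF inv] blinfun_inverses_apply[OF blinfun_inverses_inverse[OF inv[rule_format]]]
        blinfun_inverses_apply[OF blinfun_inverses_inverse[OF step1(2)]])
next
  case (step2 i)
  have eq: "evol A i = A (i - 1) o\<^sub>L evol A (i - 1)"
    using evol_Suc[OF inv, of "i - 1"] by simp
  have ev: "evol A (i - 1) v = blinfun_inverse (A (i - 1)) (evol A i v)" for v
    by (simp add: eq blinfun_inverses_apply[OF blinfun_inverses_inverse[OF inv[rule_format]]])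
  show ?case
    by (rule blinfun_invertibleI[of _ "blinfun_inverse (evol A i) o\<^sub>L A (i - 1)"])
      (simp_all add: ev blinfun_inverses_apply[OF blinfun_inverses_inverse[OF inv[rule_format]]]
        blinfun_inverses_apply[OF blinfun_inverses_inverse[OF step2(2)]])
qed

lemma evol_evol_inv:
  assumes "\<forall>n. blinfun_invertible (A n)"
  shows "evol A n (evol_inv A n v) = v" and "evol_inv A n (evol A n v) = v"
  unfolding evol_inv_def
  by (rule blinfun_inverses_apply[OF blinfun_inverses_inverse[OF evol_invertible[OF assms]]])+

lemma evol_inv_0:
  assumes "\<forall>n. blinfun_invertible (A n)"
  shows "evol_inv A 0 = id_blinfun"
  using evol_evol_inv(1)[OF assms, of 0] by (auto intro!: blinfun_eqI simp: evol_0)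

section \<open>Variation of constants\<close>

text \<open>The forcing term at time \<open>k\<close>, pulled back to time \<open>0\<close>.\<close>

definition pulled_forcing ::
    "(int \<Rightarrow> 'a::real_normed_vector \<Rightarrow>\<^sub>L 'a) \<Rightarrow> (int \<Rightarrow> 'a) \<Rightarrow> int \<Rightarrow> 'a" where
  "pulled_forcing A h k = evol_inv A (k + 1) (h k)"

text \<open>The oriented sum of the pulled-back forcing from \<open>0\<close> to \<open>n\<close>: at most one of the
  two index sets is nonempty, and the sum is taken with a minus sign when \<open>n < 0\<close>.\<close>

definition accumulated ::
    "(int \<Rightarrow> 'a::real_normed_vector \<Rightarrow>\<^sub>L 'a) \<Rightarrow> (int \<Rightarrow> 'a) \<Rightarrow> int \<Rightarrow> 'a" where
  "accumulated A h n =
     (\<Sum>k\<in>{0..n-1}. pulled_forcing A h k) - (\<Sum>k\<in>{n..-1}. pulled_forcing A h k)"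

lemma accumulated_0: "accumulated A h 0 = 0"
  by (simp add: accumulated_def)

lemma accumulated_Suc:
  "accumulated A h (n + 1) = accumulated A h n + pulled_forcing A h n"
proof (cases "0 \<le> n")
  case True
  then have "{0..n + 1 - 1} = insert n {0..n - 1}" by auto
  with True show ?thesis by (simp add: accumulated_def add.commute)
next
  case False
  then have "{n..-1} = insert n {n + 1..-1}" by auto
  with False show ?thesis by (simp add: accumulated_def)
qed

lemma is_solution_iff:
  assumes inv: "\<forall>n. blinfun_invertible (A n)"
  shows "is_solution A h x \<longleftrightarrow> (\<forall>n. x n = evol A n (x 0 + accumulated A h n))"
proof
  assume sol: "is_solution A h x"
  \<comment> \<open>In the coordinates \<open>v\<close> the equation loses its homogeneous part.\<close>
  define v where "v n = evol_inv A n (x n)" for n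
  have step: "v (n + 1) = v n + pulled_forcing A h n" for n
  proof -
    have "x (n + 1) = evol A (n + 1) (v n) + h n"
      using sol by (simp add: is_solution_def evol_Suc[OF inv] v_def evol_evol_inv[OF inv])
    then show ?thesis
      unfolding v_def[of "n + 1"] pulled_forcing_def
      by (simp add: blinfun.add_right evol_evol_inv[OF inv])
  qed
  have "v n = v 0 + accumulated A h n" for n
  proof (induction n rule: int_induct[where k = 0])
    case base
    show ?case by (simp add: accumulated_0)
  next
    case (step1 i)
    then show ?case by (simp add: step accumulated_Suc)
  next
    case (step2 i)
    then show ?case
      using step[of "i - 1"] accumulated_Suc[of A h "i - 1"] by simp
  qed
  then have "evol A n (v n) = evol A n (v 0 + accumulated A h n)" for n
    by (rule arg_cong)
  moreover have "evol A n (v n) = x n" for n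
    by (simp add: v_def evol_evol_inv[OF inv])
  moreover have "v 0 = x 0"
    by (simp add: v_def evol_inv_0[OF inv])
  ultimately show "\<forall>n. x n = evol A n (x 0 + accumulated A h n)"
    by metis
next
  assume x: "\<forall>n. x n = evol A n (x 0 + accumulated A h n)"
  have "x (n + 1) = A n (x n) + h n" for n
  proof -
    have "x (n + 1) = evol A (n + 1) (x 0 + accumulated A h n)
        + evol A (n + 1) (pulled_forcing A h n)"
      using x[rule_format, of "n + 1"]
      by (simp add: accumulated_Suc blinfun.add_right add.assoc)
    also have "evol A (n + 1) (x 0 + accumulated A h n) = A n (x n)"
      using x[rule_format, of n] by (simp add: evol_Suc[OF inv])
    also have "evol A (n + 1) (pulled_forcing A h n) = h n"
      by (simp add: pulled_forcing_def evol_evol_inv[OF inv])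
    finally show ?thesis .
  qed
  then show "is_solution A h x" by (simp add: is_solution_def)
qed

section \<open>Dichotomies on a set of times\<close>

lemma exp_dichotomyE:
  assumes "exp_dichotomy_on J A P"
  obtains c l :: real where "1 \<le> c" "0 < l" "l < 1"
    and "\<And>m n. m \<in> J \<Longrightarrow> n \<in> J \<Longrightarrow> m \<le> n \<Longrightarrow>
          norm (evol A n o\<^sub>L P o\<^sub>L evol_inv A m) \<le> c * l powi (n - m)"
    and "\<And>m n. m \<in> J \<Longrightarrow> n \<in> J \<Longrightarrow> n \<le> m \<Longrightarrow>
          norm (evol A n o\<^sub>L (id_blinfun - P) o\<^sub>L evol_inv A m) \<le> c * l powi (m - n)"
proof -
  from assms obtain c l :: real where cl: "1 \<le> c" "0 < l" "l < 1"
    and stable: "\<forall>m\<in>J. \<forall>n\<in>J. m \<le> n \<longrightarrow>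
          norm (evol A n o\<^sub>L P o\<^sub>L evol_inv A m) \<le> c * l powi (n - m)"
    and unstable: "\<forall>m\<in>J. \<forall>n\<in>J. n \<le> m \<longrightarrow>
          norm (evol A n o\<^sub>L (id_blinfun - P) o\<^sub>L evol_inv A m) \<le> c * l powi (m - n)"
    unfolding exp_dichotomy_on_def by (elim conjE exE) (rule that)
  show ?thesis
    by (rule that[OF cl stable[rule_format] unstable[rule_format]])
qed

lemma dichotomy_idem:
  assumes "exp_dichotomy_on J A P"
  shows "P (P v) = P v"
  using assms unfolding exp_dichotomy_on_def
  by (metis blinfun_apply_blinfun_compose)

text \<open>The Green's function estimate, uniform in the time \<open>n\<close> and in the set \<open>K\<close> of forcing
  times.  The condition on \<open>k + 1\<close> puts both time arguments of the kernel in \<open>J\<close>.\<close>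

lemma dichotomy_green_bound:
  fixes A :: "int \<Rightarrow> 'a::banach \<Rightarrow>\<^sub>L 'a"
  assumes dich: "exp_dichotomy_on J A P" and h: "bounded (range h)"
  obtains C where
    "\<And>n K. n \<in> J \<Longrightarrow> K \<subseteq> {..n-1} \<Longrightarrow> (\<And>k. k \<in> K \<Longrightarrow> k + 1 \<in> J) \<Longrightarrow>
       (\<lambda>k. evol A n (P (pulled_forcing A h k))) summable_on K \<and>
       norm (\<Sum>\<^sub>\<infinity>k\<in>K. evol A n (P (pulled_forcing A h k))) \<le> C"
    "\<And>n K. n \<in> J \<Longrightarrow> K \<subseteq> {n..} \<Longrightarrow> (\<And>k. k \<in> K \<Longrightarrow> k + 1 \<in> J) \<Longrightarrow>
       (\<lambda>k. evol A n ((id_blinfun - P) (pulled_forcing A h k))) summable_on K \<and>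
       norm (\<Sum>\<^sub>\<infinity>k\<in>K. evol A n ((id_blinfun - P) (pulled_forcing A h k))) \<le> C"
proof -
  obtain M where M: "\<And>k. norm (h k) \<le> M"
    using h by (auto simp: bounded_iff)
  have M0: "0 \<le> M"
    using norm_ge_zero[of "h 0"] M[of 0] by linarith
  obtain c l where c: "1 \<le> c" and l: "0 < l" "l < 1"
    and stable: "\<And>m n. m \<in> J \<Longrightarrow> n \<in> J \<Longrightarrow> m \<le> n \<Longrightarrow>
          norm (evol A n o\<^sub>L P o\<^sub>L evol_inv A m) \<le> c * l powi (n - m)"
    and unstable: "\<And>m n. m \<in> J \<Longrightarrow> n \<in> J \<Longrightarrow> n \<le> m \<Longrightarrow>
          norm (evol A n o\<^sub>L (id_blinfun - P) o\<^sub>L evol_inv A m) \<le> c * l powi (m - n)"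
    using dich by (rule exp_dichotomyE) (rule that)
  have apply_le: "norm (T (h k)) \<le> c * M * l ^ i"
    if "norm T \<le> c * l powi j" "j = int i" for T :: "'a \<Rightarrow>\<^sub>L 'a" and k i j
  proof -
    have "norm (T (h k)) \<le> norm T * norm (h k)"
      by (rule norm_blinfun)
    also have "\<dots> \<le> (c * l powi j) * M"
      using that c l M by (intro mult_mono) auto
    finally show ?thesis using that by (simp add: mult_ac)
  qed
  have C0: "0 \<le> c * M" using c M0 by simp
  show ?thesis
  proof (rule that)
    fix n K assume n: "n \<in> J" and K: "K \<subseteq> {..n-1}" and J: "\<And>k. k \<in> K \<Longrightarrow> k + 1 \<in> J"
    have less: "k < n" if "k \<in> K" for k using K that by force
    have bound: "norm (evol A n (P (pulled_forcing A h k))) \<le> c * M * l ^ nat (n - (k + 1))"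
      if "k \<in> K" for k
      using apply_le[OF stable[OF J[OF that] n], of "nat (n - (k + 1))" k] less[OF that]
      by (simp add: pulled_forcing_def)
    have inj: "inj_on (\<lambda>k. nat (n - (k + 1))) K"
      by (auto intro!: inj_onI dest!: less)
    show "(\<lambda>k. evol A n (P (pulled_forcing A h k))) summable_on K \<and>
       norm (\<Sum>\<^sub>\<infinity>k\<in>K. evol A n (P (pulled_forcing A h k))) \<le> c * M / (1 - l)"
      by (intro conjI summable_on_geometric_bound[OF l C0 inj bound])
  next
    fix n K assume n: "n \<in> J" and K: "K \<subseteq> {n..}" and J: "\<And>k. k \<in> K \<Longrightarrow> k + 1 \<in> J"
    have le: "n \<le> k" if "k \<in> K" for k using K that by force
    have bound: "norm (evol A n ((id_blinfun - P) (pulled_forcing A h k)))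
        \<le> c * M * l ^ nat (k + 1 - n)" if "k \<in> K" for k
      using apply_le[OF unstable[OF J[OF that] n], of "nat (k + 1 - n)" k] le[OF that]
      by (simp add: pulled_forcing_def)
    have inj: "inj_on (\<lambda>k. nat (k + 1 - n)) K"
      by (auto intro!: inj_onI dest!: le)
    show "(\<lambda>k. evol A n ((id_blinfun - P) (pulled_forcing A h k))) summable_on K \<and>
       norm (\<Sum>\<^sub>\<infinity>k\<in>K. evol A n ((id_blinfun - P) (pulled_forcing A h k))) \<le> c * M / (1 - l)"
      by (intro conjI summable_on_geometric_bound[OF l C0 inj bound])
  qed
qed

lemma dichotomy_forward_bounded:
  fixes A :: "int \<Rightarrow> 'a::banach \<Rightarrow>\<^sub>L 'a"
  assumes inv: "\<forall>n. blinfun_invertible (A n)" and dich: "exp_dichotomy_on {0..} A P"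
  shows "bounded ((\<lambda>n. evol A n (P v)) ` {0..})"
proof -
  obtain c l where c: "1 \<le> c" and l: "0 < l" "l < 1"
    and stable: "\<And>m n. m \<in> {0..} \<Longrightarrow> n \<in> {0..} \<Longrightarrow> m \<le> n \<Longrightarrow>
          norm (evol A n o\<^sub>L P o\<^sub>L evol_inv A m) \<le> c * l powi (n - m)"
    using dich by (rule exp_dichotomyE) (rule that)
  have "norm (evol A n (P v)) \<le> c * norm v" if "n \<in> {0..}" for n
  proof -
    have "norm (evol A n (P v)) \<le> norm (evol A n o\<^sub>L P o\<^sub>L evol_inv A 0) * norm v"
      using norm_blinfun[of "evol A n o\<^sub>L P o\<^sub>L evol_inv A 0" v] by (simp add: evol_inv_0[OF inv])
    moreover have "l powi n \<le> 1"
      using l that by (simp add: power_int_def power_le_one)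
    then have "c * l powi n \<le> c" using c by simp
    then have "norm (evol A n o\<^sub>L P o\<^sub>L evol_inv A 0) \<le> c"
      using stable[of 0 n] that by simp
    ultimately show ?thesis
      by (meson mult_right_mono norm_ge_zero order_trans)
  qed
  then show ?thesis by (auto simp: bounded_iff)
qed

lemma dichotomy_backward_bounded:
  fixes A :: "int \<Rightarrow> 'a::banach \<Rightarrow>\<^sub>L 'a"
  assumes inv: "\<forall>n. blinfun_invertible (A n)" and dich: "exp_dichotomy_on {..0} A Q"
  shows "bounded ((\<lambda>n. evol A n ((id_blinfun - Q) v)) ` {..0})"
proof -
  obtain c l where c: "1 \<le> c" and l: "0 < l" "l < 1"
    and unstable: "\<And>m n. m \<in> {..0} \<Longrightarrow> n \<in> {..0} \<Longrightarrow> n \<le> m \<Longrightarrow>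
          norm (evol A n o\<^sub>L (id_blinfun - Q) o\<^sub>L evol_inv A m) \<le> c * l powi (m - n)"
    using dich by (rule exp_dichotomyE) (rule that)
  have "norm (evol A n ((id_blinfun - Q) v)) \<le> c * norm v" if "n \<in> {..0}" for n
  proof -
    have "norm (evol A n ((id_blinfun - Q) v))
        \<le> norm (evol A n o\<^sub>L (id_blinfun - Q) o\<^sub>L evol_inv A 0) * norm v"
      using norm_blinfun[of "evol A n o\<^sub>L (id_blinfun - Q) o\<^sub>L evol_inv A 0" v]
      by (simp add: evol_inv_0[OF inv])
    moreover have "l powi (0 - n) \<le> 1"
      using l that by (simp add: power_int_def power_le_one)
    then have "c * l powi (0 - n) \<le> c" using c by simp
    then have "norm (evol A n o\<^sub>L (id_blinfun - Q) o\<^sub>L evol_inv A 0) \<le> c"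
      using unstable[of 0 n] that by simp
    ultimately show ?thesis
      by (meson mult_right_mono norm_ge_zero order_trans)
  qed
  then show ?thesis by (auto simp: bounded_iff)
qed

lemma eq_0_if_geometric_bound:
  fixes w :: "'a::real_normed_vector" and c l M :: real
  assumes "0 < l" "l < 1" and "\<And>i. norm w \<le> c * l ^ i * M"
  shows "w = 0"
proof -
  have "(\<lambda>i. c * l ^ i * M) \<longlonglongrightarrow> c * 0 * M"
    using assms by (intro tendsto_intros LIMSEQ_power_zero) auto
  then have "norm w \<le> c * 0 * M"
    by (rule LIMSEQ_le_const) (use assms(3) in blast)
  then show ?thesis by simp
qed

text \<open>Homogeneous trajectories bounded on \<open>{0..}\<close> start in the range of \<open>P\<close>: the component of the initial
  value outside is recovered from time \<open>n\<close> with a factor that decays in \<open>n\<close>.\<close>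

lemma dichotomy_forward_unstable_0:
  fixes A :: "int \<Rightarrow> 'a::banach \<Rightarrow>\<^sub>L 'a"
  assumes inv: "\<forall>n. blinfun_invertible (A n)" and dich: "exp_dichotomy_on {0..} A P"
    and bdd: "bounded ((\<lambda>n. evol A n v) ` {0..})"
  shows "P v = v"
proof -
  obtain c l where c: "1 \<le> c" and l: "0 < l" "l < 1"
    and unstable: "\<And>m n. m \<in> {0..} \<Longrightarrow> n \<in> {0..} \<Longrightarrow> n \<le> m \<Longrightarrow>
          norm (evol A n o\<^sub>L (id_blinfun - P) o\<^sub>L evol_inv A m) \<le> c * l powi (m - n)"
    using dich by (rule exp_dichotomyE) (rule that)
  obtain M where M: "\<And>n. 0 \<le> n \<Longrightarrow> norm (evol A n v) \<le> M"
    using bdd by (auto simp: bounded_iff)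
  have "norm ((id_blinfun - P) v) \<le> c * l ^ i * M" for i
  proof -
    let ?T = "evol A 0 o\<^sub>L (id_blinfun - P) o\<^sub>L evol_inv A (int i)"
    have "norm ((id_blinfun - P) v) = norm (?T (evol A (int i) v))"
      by (simp add: evol_0 evol_evol_inv[OF inv])
    also have "\<dots> \<le> norm ?T * norm (evol A (int i) v)"
      by (rule norm_blinfun)
    also have "\<dots> \<le> (c * l ^ i) * M"
      using unstable[of "int i" 0] c l M[of "int i"] by (intro mult_mono) auto
    finally show ?thesis .
  qed
  then have "(id_blinfun - P) v = 0"
    using l by (rule eq_0_if_geometric_bound[rotated 2])
  then show ?thesis by (simp add: blinfun.diff_left)
qed

text \<open>Homogeneous trajectories bounded on \<open>{..0}\<close> start in the kernel of \<open>Q\<close>, by the same argument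
  in the other time direction.\<close>

lemma dichotomy_backward_stable_0:
  fixes A :: "int \<Rightarrow> 'a::banach \<Rightarrow>\<^sub>L 'a"
  assumes inv: "\<forall>n. blinfun_invertible (A n)" and dich: "exp_dichotomy_on {..0} A Q"
    and bdd: "bounded ((\<lambda>n. evol A n v) ` {..0})"
  shows "Q v = 0"
proof -
  obtain c l where c: "1 \<le> c" and l: "0 < l" "l < 1"
    and stable: "\<And>m n. m \<in> {..0} \<Longrightarrow> n \<in> {..0} \<Longrightarrow> m \<le> n \<Longrightarrow>
          norm (evol A n o\<^sub>L Q o\<^sub>L evol_inv A m) \<le> c * l powi (n - m)"
    using dich by (rule exp_dichotomyE) (rule that)
  obtain M where M: "\<And>n. n \<le> 0 \<Longrightarrow> norm (evol A n v) \<le> M"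
    using bdd by (auto simp: bounded_iff)
  have "norm (Q v) \<le> c * l ^ i * M" for i
  proof -
    let ?T = "evol A 0 o\<^sub>L Q o\<^sub>L evol_inv A (- int i)"
    have "norm (Q v) = norm (?T (evol A (- int i) v))"
      by (simp add: evol_0 evol_evol_inv[OF inv])
    also have "\<dots> \<le> norm ?T * norm (evol A (- int i) v)"
      by (rule norm_blinfun)
    also have "\<dots> \<le> (c * l ^ i) * M"
      using stable[of "- int i" 0] c l M[of "- int i"] by (intro mult_mono) auto
    finally show ?thesis .
  qed
  then show ?thesis
    using l by (rule eq_0_if_geometric_bound[rotated 2])
qed

section \<open>Bounded solutions on the half-axes\<close>

text \<open>The part of the forcing on \<open>{0..}\<close> that a forward bounded solution must cancel.\<close>

definition forward_load ::
    "(int \<Rightarrow> 'a::real_normed_vector \<Rightarrow>\<^sub>L 'a) \<Rightarrow> ('a \<Rightarrow>\<^sub>L 'a) \<Rightarrow> (int \<Rightarrow> 'a) \<Rightarrow> 'a" where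
  "forward_load A P h = (\<Sum>\<^sub>\<infinity>k\<in>{0..}. (id_blinfun - P) (pulled_forcing A h k))"

text \<open>The part of the forcing on \<open>{..-1}\<close> that arrives at time \<open>0\<close> along a backward bounded
  solution.\<close>

definition backward_load ::
    "(int \<Rightarrow> 'a::real_normed_vector \<Rightarrow>\<^sub>L 'a) \<Rightarrow> ('a \<Rightarrow>\<^sub>L 'a) \<Rightarrow> (int \<Rightarrow> 'a) \<Rightarrow> 'a" where
  "backward_load A Q h = (\<Sum>\<^sub>\<infinity>k\<in>{..-1}. Q (pulled_forcing A h k))"

lemma G_bracket_eq: "G_bracket A P Q h = forward_load A P h + backward_load A Q h"
  by (simp add: G_bracket_def forward_load_def backward_load_def pulled_forcing_def)

lemma forward_summable:
  fixes A :: "int \<Rightarrow> 'a::banach \<Rightarrow>\<^sub>L 'a"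
  assumes dich: "exp_dichotomy_on {0..} A P" and h: "bounded (range h)"
  shows "(\<lambda>k. (id_blinfun - P) (pulled_forcing A h k)) summable_on {0..}"
proof -
  obtain C where
    "\<And>n K. n \<in> {0..} \<Longrightarrow> K \<subseteq> {n..} \<Longrightarrow> (\<And>k. k \<in> K \<Longrightarrow> k + 1 \<in> {0..}) \<Longrightarrow>
       (\<lambda>k. evol A n ((id_blinfun - P) (pulled_forcing A h k))) summable_on K \<and>
       norm (\<Sum>\<^sub>\<infinity>k\<in>K. evol A n ((id_blinfun - P) (pulled_forcing A h k))) \<le> C"
    by (rule dichotomy_green_bound[OF dich h]) blast
  from this[of 0 "{0..}"] show ?thesis by (simp add: evol_0)
qed

lemma backward_summable:
  fixes A :: "int \<Rightarrow> 'a::banach \<Rightarrow>\<^sub>L 'a"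
  assumes dich: "exp_dichotomy_on {..0} A Q" and h: "bounded (range h)"
  shows "(\<lambda>k. Q (pulled_forcing A h k)) summable_on {..-1}"
proof -
  obtain C where
    "\<And>n K. n \<in> {..0} \<Longrightarrow> K \<subseteq> {..n-1} \<Longrightarrow> (\<And>k. k \<in> K \<Longrightarrow> k + 1 \<in> {..0}) \<Longrightarrow>
       (\<lambda>k. evol A n (Q (pulled_forcing A h k))) summable_on K \<and>
       norm (\<Sum>\<^sub>\<infinity>k\<in>K. evol A n (Q (pulled_forcing A h k))) \<le> C"
    by (rule dichotomy_green_bound[OF dich h]) blast
  from this[of 0 "{..-1}"] show ?thesis by (simp add: evol_0)
qed

text \<open>The forward load lies in the kernel of \<open>P\<close> and the backward load in the range of \<open>Q\<close>, since
  a bounded projector may be applied to the series termwise.\<close>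

lemma projection_forward_load:
  fixes A :: "int \<Rightarrow> 'a::banach \<Rightarrow>\<^sub>L 'a"
  assumes dich: "exp_dichotomy_on {0..} A P" and h: "bounded (range h)"
  shows "P (forward_load A P h) = 0"
  unfolding forward_load_def infsum_blinfun_apply[OF forward_summable[OF dich h], symmetric]
  by (simp add: blinfun.diff_left blinfun.diff_right dichotomy_idem[OF dich])

lemma projection_backward_load:
  fixes A :: "int \<Rightarrow> 'a::banach \<Rightarrow>\<^sub>L 'a"
  assumes dich: "exp_dichotomy_on {..0} A Q" and h: "bounded (range h)"
  shows "Q (backward_load A Q h) = backward_load A Q h"
  unfolding backward_load_def infsum_blinfun_apply[OF backward_summable[OF dich h], symmetric]
  by (simp add: dichotomy_idem[OF dich])

text \<open>Completing the tail \<open>{n..}\<close> to the whole of \<open>{0..}\<close> shows that the Green's function sums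
  are a single trajectory of the inhomogeneous equation, started at \<open>- forward_load\<close>.\<close>

lemma forward_green_eq:
  fixes A :: "int \<Rightarrow> 'a::banach \<Rightarrow>\<^sub>L 'a"
  assumes dich: "exp_dichotomy_on {0..} A P" and h: "bounded (range h)" and n: "0 \<le> n"
  shows "(\<Sum>k\<in>{0..n-1}. evol A n (P (pulled_forcing A h k))) -
     (\<Sum>\<^sub>\<infinity>k\<in>{n..}. evol A n ((id_blinfun - P) (pulled_forcing A h k))) =
     evol A n (accumulated A h n - forward_load A P h)"
proof -
  let ?g = "pulled_forcing A h"
  let ?f = "\<lambda>k. (id_blinfun - P) (?g k)"
  have sn: "?f summable_on {n..}"
    by (rule summable_on_subset_banach[OF forward_summable[OF dich h]]) (use n in auto)
  have "{0..} = {0..n-1} \<union> {n..}" using n by auto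
  then have "forward_load A P h = infsum ?f ({0..n-1} \<union> {n..})"
    by (simp only: forward_load_def)
  also have "\<dots> = infsum ?f {0..n-1} + infsum ?f {n..}"
    by (rule infsum_Un_disjoint) (use sn in auto)
  finally have split: "forward_load A P h = sum ?f {0..n-1} + infsum ?f {n..}"
    by simp
  have "accumulated A h n = (\<Sum>k\<in>{0..n-1}. P (?g k)) + sum ?f {0..n-1}"
    using n by (simp add: accumulated_def blinfun.diff_left sum_subtractf)
  then have "accumulated A h n - forward_load A P h
      = (\<Sum>k\<in>{0..n-1}. P (?g k)) - infsum ?f {n..}"
    by (simp add: split)
  then show ?thesis
    by (simp add: blinfun.diff_right blinfun.sum_right infsum_blinfun_apply[OF sn])
qed

text \<open>Likewise at negative times, with the trajectory started at \<open>backward_load\<close>.\<close>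

lemma backward_green_eq:
  fixes A :: "int \<Rightarrow> 'a::banach \<Rightarrow>\<^sub>L 'a"
  assumes dich: "exp_dichotomy_on {..0} A Q" and h: "bounded (range h)" and n: "n \<le> 0"
  shows "(\<Sum>\<^sub>\<infinity>k\<in>{..n-1}. evol A n (Q (pulled_forcing A h k))) -
     (\<Sum>k\<in>{n..-1}. evol A n ((id_blinfun - Q) (pulled_forcing A h k))) =
     evol A n (accumulated A h n + backward_load A Q h)"
proof -
  let ?g = "pulled_forcing A h"
  let ?f = "\<lambda>k. Q (?g k)"
  have sn: "?f summable_on {..n-1}"
    by (rule summable_on_subset_banach[OF backward_summable[OF dich h]]) (use n in auto)
  have "{..-1} = {..n-1} \<union> {n..-1}" using n by auto
  then have "backward_load A Q h = infsum ?f ({..n-1} \<union> {n..-1})"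
    by (simp only: backward_load_def)
  also have "\<dots> = infsum ?f {..n-1} + infsum ?f {n..-1}"
    by (rule infsum_Un_disjoint) (use sn in auto)
  finally have split: "backward_load A Q h = infsum ?f {..n-1} + sum ?f {n..-1}"
    by simp
  have "accumulated A h n
      = - sum ?f {n..-1} - (\<Sum>k\<in>{n..-1}. (id_blinfun - Q) (?g k))"
    using n by (simp add: accumulated_def blinfun.diff_left sum_subtractf)
  then have "accumulated A h n + backward_load A Q h
      = infsum ?f {..n-1} - (\<Sum>k\<in>{n..-1}. (id_blinfun - Q) (?g k))"
    by (simp add: split)
  then show ?thesis
    by (simp add: blinfun.diff_right blinfun.sum_right infsum_blinfun_apply[OF sn])
qed

lemma forward_particular_bounded:
  fixes A :: "int \<Rightarrow> 'a::banach \<Rightarrow>\<^sub>L 'a"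
  assumes dich: "exp_dichotomy_on {0..} A P" and h: "bounded (range h)"
  shows "bounded ((\<lambda>n. evol A n (accumulated A h n - forward_load A P h)) ` {0..})"
proof -
  obtain C where C1: "\<And>n K. n \<in> {0..} \<Longrightarrow> K \<subseteq> {..n-1} \<Longrightarrow>
       (\<And>k. k \<in> K \<Longrightarrow> k + 1 \<in> {0..}) \<Longrightarrow>
       (\<lambda>k. evol A n (P (pulled_forcing A h k))) summable_on K \<and>
       norm (\<Sum>\<^sub>\<infinity>k\<in>K. evol A n (P (pulled_forcing A h k))) \<le> C"
    and C2: "\<And>n K. n \<in> {0..} \<Longrightarrow> K \<subseteq> {n..} \<Longrightarrow> (\<And>k. k \<in> K \<Longrightarrow> k + 1 \<in> {0..}) \<Longrightarrow>
       (\<lambda>k. evol A n ((id_blinfun - P) (pulled_forcing A h k))) summable_on K \<and>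
       norm (\<Sum>\<^sub>\<infinity>k\<in>K. evol A n ((id_blinfun - P) (pulled_forcing A h k))) \<le> C"
    by (rule dichotomy_green_bound[OF dich h]) blast
  have "norm (evol A n (accumulated A h n - forward_load A P h)) \<le> C + C" if "n \<in> {0..}" for n
  proof -
    have n: "0 \<le> n" using that by simp
    have "norm (\<Sum>k\<in>{0..n-1}. evol A n (P (pulled_forcing A h k))) \<le> C"
      using C1[OF that, of "{0..n-1}"] by auto
    moreover have
      "norm (\<Sum>\<^sub>\<infinity>k\<in>{n..}. evol A n ((id_blinfun - P) (pulled_forcing A h k))) \<le> C"
      using C2[OF that, of "{n..}"] n by auto
    ultimately show ?thesis
      unfolding forward_green_eq[OF dich h n, symmetric]
      by (meson add_mono norm_triangle_ineq4 order_trans)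
  qed
  then show ?thesis by (auto simp: bounded_iff)
qed

lemma backward_particular_bounded:
  fixes A :: "int \<Rightarrow> 'a::banach \<Rightarrow>\<^sub>L 'a"
  assumes dich: "exp_dichotomy_on {..0} A Q" and h: "bounded (range h)"
  shows "bounded ((\<lambda>n. evol A n (accumulated A h n + backward_load A Q h)) ` {..0})"
proof -
  obtain C where C1: "\<And>n K. n \<in> {..0} \<Longrightarrow> K \<subseteq> {..n-1} \<Longrightarrow>
       (\<And>k. k \<in> K \<Longrightarrow> k + 1 \<in> {..0}) \<Longrightarrow>
       (\<lambda>k. evol A n (Q (pulled_forcing A h k))) summable_on K \<and>
       norm (\<Sum>\<^sub>\<infinity>k\<in>K. evol A n (Q (pulled_forcing A h k))) \<le> C"
    and C2: "\<And>n K. n \<in> {..0} \<Longrightarrow> K \<subseteq> {n..} \<Longrightarrow> (\<And>k. k \<in> K \<Longrightarrow> k + 1 \<in> {..0}) \<Longrightarrow>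
       (\<lambda>k. evol A n ((id_blinfun - Q) (pulled_forcing A h k))) summable_on K \<and>
       norm (\<Sum>\<^sub>\<infinity>k\<in>K. evol A n ((id_blinfun - Q) (pulled_forcing A h k))) \<le> C"
    by (rule dichotomy_green_bound[OF dich h]) blast
  have "norm (evol A n (accumulated A h n + backward_load A Q h)) \<le> C + C"
    if "n \<in> {..0}" for n
  proof -
    have n: "n \<le> 0" using that by simp
    have "norm (\<Sum>\<^sub>\<infinity>k\<in>{..n-1}. evol A n (Q (pulled_forcing A h k))) \<le> C"
      using C1[OF that, of "{..n-1}"] n by auto
    moreover have
      "norm (\<Sum>k\<in>{n..-1}. evol A n ((id_blinfun - Q) (pulled_forcing A h k))) \<le> C"
      using C2[OF that, of "{n..-1}"] by auto
    ultimately show ?thesis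
      unfolding backward_green_eq[OF dich h n, symmetric]
      by (meson add_mono norm_triangle_ineq4 order_trans)
  qed
  then show ?thesis by (auto simp: bounded_iff)
qed

text \<open>Subtracting the bounded particular trajectory reduces the claim to the homogeneous equation
  with initial value \<open>v + forward_load\<close>.\<close>

lemma forward_bounded_iff:
  fixes A :: "int \<Rightarrow> 'a::banach \<Rightarrow>\<^sub>L 'a"
  assumes inv: "\<forall>n. blinfun_invertible (A n)"
    and dich: "exp_dichotomy_on {0..} A P" and h: "bounded (range h)"
  shows "bounded ((\<lambda>n. evol A n (v + accumulated A h n)) ` {0..}) \<longleftrightarrow>
         P v = v + forward_load A P h"
proof -
  let ?a = "forward_load A P h"
  have split: "evol A n (v + accumulated A h n)
      = evol A n (v + ?a) + evol A n (accumulated A h n - ?a)" for n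
    by (simp add: blinfun.add_right blinfun.diff_right)
  have hom: "bounded ((\<lambda>n. evol A n (v + ?a)) ` {0..}) \<longleftrightarrow>
      bounded ((\<lambda>n. evol A n (v + accumulated A h n)) ` {0..})"
  proof
    assume "bounded ((\<lambda>n. evol A n (v + ?a)) ` {0..})"
    then show "bounded ((\<lambda>n. evol A n (v + accumulated A h n)) ` {0..})"
      unfolding split
      by (intro bounded_plus_comp forward_particular_bounded[OF dich h])
  next
    assume "bounded ((\<lambda>n. evol A n (v + accumulated A h n)) ` {0..})"
    from bounded_minus_comp[OF this forward_particular_bounded[OF dich h]]
    show "bounded ((\<lambda>n. evol A n (v + ?a)) ` {0..})"
      unfolding split by simp
  qed
  have "bounded ((\<lambda>n. evol A n (v + ?a)) ` {0..}) \<longleftrightarrow> P (v + ?a) = v + ?a"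
    using dichotomy_forward_bounded[OF inv dich, of "v + ?a"]
      dichotomy_forward_unstable_0[OF inv dich, of "v + ?a"] by auto
  then show ?thesis
    unfolding hom by (simp add: blinfun.add_right projection_forward_load[OF dich h])
qed

lemma backward_bounded_iff:
  fixes A :: "int \<Rightarrow> 'a::banach \<Rightarrow>\<^sub>L 'a"
  assumes inv: "\<forall>n. blinfun_invertible (A n)"
    and dich: "exp_dichotomy_on {..0} A Q" and h: "bounded (range h)"
  shows "bounded ((\<lambda>n. evol A n (v + accumulated A h n)) ` {..0}) \<longleftrightarrow>
         Q v = backward_load A Q h"
proof -
  let ?b = "backward_load A Q h"
  have split: "evol A n (v + accumulated A h n)
      = evol A n (v - ?b) + evol A n (accumulated A h n + ?b)" for n
    by (simp add: blinfun.add_right blinfun.diff_right)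
  have hom: "bounded ((\<lambda>n. evol A n (v - ?b)) ` {..0}) \<longleftrightarrow>
      bounded ((\<lambda>n. evol A n (v + accumulated A h n)) ` {..0})"
  proof
    assume "bounded ((\<lambda>n. evol A n (v - ?b)) ` {..0})"
    then show "bounded ((\<lambda>n. evol A n (v + accumulated A h n)) ` {..0})"
      unfolding split
      by (intro bounded_plus_comp backward_particular_bounded[OF dich h])
  next
    assume "bounded ((\<lambda>n. evol A n (v + accumulated A h n)) ` {..0})"
    from bounded_minus_comp[OF this backward_particular_bounded[OF dich h]]
    show "bounded ((\<lambda>n. evol A n (v - ?b)) ` {..0})"
      unfolding split by simp
  qed
  have "bounded ((\<lambda>n. evol A n (v - ?b)) ` {..0}) \<longleftrightarrow> Q (v - ?b) = 0"
    using dichotomy_backward_bounded[OF inv dich, of "v - ?b"]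
      dichotomy_backward_stable_0[OF inv dich, of "v - ?b"]
    by (auto simp: blinfun.diff_left)
  then show ?thesis
    unfolding hom by (simp add: blinfun.diff_right projection_backward_load[OF dich h])
qed

section \<open>Bounded solutions on the whole axis\<close>

lemma bounded_solution_iff:
  fixes A :: "int \<Rightarrow> 'a::banach \<Rightarrow>\<^sub>L 'a"
  assumes inv: "\<forall>n. blinfun_invertible (A n)" and h: "bounded (range h)"
    and P: "exp_dichotomy_on {0..} A P" and Q: "exp_dichotomy_on {..0} A Q"
  shows "is_solution A h x \<and> bounded (range x) \<longleftrightarrow>
    (\<forall>n. x n = evol A n (x 0 + accumulated A h n)) \<and>
    P (x 0) = x 0 + forward_load A P h \<and> Q (x 0) = backward_load A Q h"
proof (cases "\<forall>n. x n = evol A n (x 0 + accumulated A h n)")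
  case True
  then have x: "(\<lambda>n. evol A n (x 0 + accumulated A h n)) = x"
    by (intro ext) (rule True[rule_format, symmetric])
  have "range x = x ` ({0..} \<union> {..0})"
    by (rule arg_cong[of _ _ "(`) x"]) auto
  then have "bounded (range x) \<longleftrightarrow> bounded (x ` {0..}) \<and> bounded (x ` {..0})"
    by (simp only: image_Un bounded_Un)
  then show ?thesis
    using forward_bounded_iff[OF inv P h, of "x 0"] backward_bounded_iff[OF inv Q h, of "x 0"]
      iffD2[OF is_solution_iff[OF inv] True] True unfolding x by iprover
next
  case False
  then show ?thesis unfolding is_solution_iff[OF inv] by iprover
qed

lemma G_plus_eq:
  fixes A :: "int \<Rightarrow> 'a::banach \<Rightarrow>\<^sub>L 'a"
  assumes dich: "exp_dichotomy_on {0..} A P" and h: "bounded (range h)" and n: "0 \<le> n"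
  shows "G_plus A P Q Dm h n = evol A n
     (P (Dm (G_bracket A P Q h)) - forward_load A P h + accumulated A h n)"
  using forward_green_eq[OF dich h n]
  by (simp add: G_plus_def pulled_forcing_def blinfun.add_right blinfun.diff_right)

lemma G_minus_eq:
  fixes A :: "int \<Rightarrow> 'a::banach \<Rightarrow>\<^sub>L 'a"
  assumes dich: "exp_dichotomy_on {..0} A Q" and h: "bounded (range h)" and n: "n \<le> 0"
  shows "G_minus A P Q Dm h n = evol A n
     ((id_blinfun - Q) (Dm (G_bracket A P Q h)) + backward_load A Q h + accumulated A h n)"
  using backward_green_eq[OF dich h n]
  by (simp add: G_minus_def pulled_forcing_def blinfun.add_right blinfun.diff_right)

text \<open>The two expressions for \<open>H\<close> agree because \<open>Q - (I - P)\<close> is \<open>D\<close>, which the projector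
  annihilates.\<close>

lemma proj_corange_compose:
  assumes "generalized_inverse (dich_op P Q) Dm"
  shows "proj_corange (dich_op P Q) Dm (Q v) = proj_corange (dich_op P Q) Dm ((id_blinfun - P) v)"
proof -
  let ?D = "dich_op P Q"
  have "?D (Dm (?D v)) = ?D v"
    using assms unfolding generalized_inverse_def by (metis blinfun_apply_blinfun_compose)
  then have "proj_corange ?D Dm (?D v) = 0"
    by (simp add: proj_corange_def blinfun.diff_left)
  moreover have "?D v = Q v - (id_blinfun - P) v"
    by (simp add: dich_op_def blinfun.diff_left)
  ultimately show ?thesis by (simp add: blinfun.diff_right)
qed

lemma H_op_has_sum:
  fixes A :: "int \<Rightarrow> 'a::banach \<Rightarrow>\<^sub>L 'a"
  assumes h: "bounded (range h)"
    and P: "exp_dichotomy_on {0..} A P" and Q: "exp_dichotomy_on {..0} A Q"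
    and D: "generalized_inverse (dich_op P Q) Dm"
  shows "((\<lambda>k. H_op A P Q Dm (k + 1) (h k)) has_sum
      proj_corange (dich_op P Q) Dm (G_bracket A P Q h)) UNIV"
proof -
  let ?R = "proj_corange (dich_op P Q) Dm"
  let ?f = "\<lambda>k. H_op A P Q Dm (k + 1) (h k)"
  have f: "?f k = ?R (Q (pulled_forcing A h k))" for k
    by (simp add: H_op_def pulled_forcing_def)
  have f': "?f k = ?R ((id_blinfun - P) (pulled_forcing A h k))" for k
    unfolding f by (rule proj_corange_compose[OF D])
  have "(?f has_sum ?R (forward_load A P h)) {0..}"
    unfolding f' forward_load_def
    by (rule has_sum_bounded_linear[OF blinfun.bounded_linear_right
          has_sum_infsum[OF forward_summable[OF P h]]])
  moreover have "(?f has_sum ?R (backward_load A Q h)) {..-1}"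
    unfolding f backward_load_def
    by (rule has_sum_bounded_linear[OF blinfun.bounded_linear_right
          has_sum_infsum[OF backward_summable[OF Q h]]])
  ultimately have "(?f has_sum (?R (forward_load A P h) + ?R (backward_load A Q h))) ({0..} \<union> {..-1})"
    by (rule has_sum_Un_disjoint) auto
  moreover have "{0..} \<union> {..-1} = (UNIV :: int set)" by auto
  ultimately show ?thesis by (simp add: G_bracket_eq blinfun.add_right)
qed

theorem theorem2:
  fixes A :: "int \<Rightarrow> 'a::banach \<Rightarrow>\<^sub>L 'a"
    and h :: "int \<Rightarrow> 'a"
    and P Q Dm :: "'a \<Rightarrow>\<^sub>L 'a"
  assumes "bounded (range A)"
    and "\<And>n. blinfun_invertible (A n)"
    and "bounded (range h)"
    and "exp_dichotomy_on {0..} A P"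
    and "exp_dichotomy_on {..0} A Q"
    and "generalized_inverse (dich_op P Q) Dm"
  shows
    "(\<forall>k. H_op A P Q Dm (k + 1) =
          proj_corange (dich_op P Q) Dm o\<^sub>L (id_blinfun - P) o\<^sub>L evol_inv A (k + 1)) \<and>
     (\<lambda>k. H_op A P Q Dm (k + 1) (h k)) summable_on UNIV \<and>
     (\<forall>n\<ge>0. (\<lambda>k. (evol A n o\<^sub>L (id_blinfun - P) o\<^sub>L evol_inv A (k + 1)) (h k))
                summable_on {n..}) \<and>
     (\<forall>n\<le>0. (\<lambda>k. (evol A n o\<^sub>L Q o\<^sub>L evol_inv A (k + 1)) (h k)) summable_on {..n-1}) \<and>
     ((\<exists>x. is_solution A h x \<and> bounded (range x)) \<longleftrightarrow>
        (\<Sum>\<^sub>\<infinity>k\<in>UNIV. H_op A P Q Dm (k + 1) (h k)) = 0) \<and>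
     G_plus A P Q Dm h 0 - G_minus A P Q Dm h 0 =
        - (\<Sum>\<^sub>\<infinity>k\<in>UNIV. H_op A P Q Dm (k + 1) (h k)) \<and>
     ((\<Sum>\<^sub>\<infinity>k\<in>UNIV. H_op A P Q Dm (k + 1) (h k)) = 0 \<longrightarrow>
        {x. is_solution A h x \<and> bounded (range x)} =
          range (\<lambda>c n. (evol A n o\<^sub>L P o\<^sub>L proj_kernel (dich_op P Q) Dm) c
                        + G_op A P Q Dm h n) \<and>
        G_plus A P Q Dm h 0 - G_minus A P Q Dm h 0 = 0 \<and>
        bounded (range (G_op A P Q Dm h)) \<and>
        (\<forall>n. L_op A (G_op A P Q Dm h) n = h n))"
proof -
  have inv: "\<forall>n. blinfun_invertible (A n)" using assms(2) by blast
  note h = assms(3) and P = assms(4) and Q = assms(5) and gi = assms(6)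
  let ?D = "dich_op P Q" and ?R = "proj_corange (dich_op P Q) Dm"
    and ?N = "proj_kernel (dich_op P Q) Dm" and ?G = "G_op A P Q Dm h"
  let ?S = "\<Sum>\<^sub>\<infinity>k\<in>UNIV. H_op A P Q Dm (k + 1) (h k)"
  define a where "a = forward_load A P h"
  define b where "b = backward_load A Q h"
  define w where "w = Dm (a + b)"
  have bracket: "G_bracket A P Q h = a + b"
    by (simp add: G_bracket_eq a_def b_def)
  have D_apply: "?D v = P v - v + Q v" for v
    by (simp add: dich_op_def blinfun.diff_left)
  have DDD: "?D (Dm (?D v)) = ?D v" for v
    using gi unfolding generalized_inverse_def by (metis blinfun_apply_blinfun_compose)
  have R_apply: "?R v = v - ?D (Dm v)" for v
    by (simp add: proj_corange_def blinfun.diff_left)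
  have S: "?S = ?R (a + b)"
    using H_op_has_sum[OF h P Q gi] unfolding bracket by (rule infsumI)
  have sol_iff: "is_solution A h x \<and> bounded (range x) \<longleftrightarrow>
      (\<forall>n. x n = evol A n (x 0 + accumulated A h n)) \<and> P (x 0) = x 0 + a \<and> Q (x 0) = b" for x
    unfolding a_def b_def by (rule bounded_solution_iff[OF inv h P Q])
  have sol_0: "P (x 0) = x 0 + a" "Q (x 0) = b"
    if "is_solution A h x \<and> bounded (range x)" for x
    using that unfolding sol_iff by iprover+

  have H_eq: "H_op A P Q Dm (k + 1) =
      ?R o\<^sub>L (id_blinfun - P) o\<^sub>L evol_inv A (k + 1)" for k
    by (rule blinfun_eqI) (simp add: H_op_def proj_corange_compose[OF gi])
  have H_sum: "(\<lambda>k. H_op A P Q Dm (k + 1) (h k)) summable_on UNIV"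
    using H_op_has_sum[OF h P Q gi] by (rule has_sum_imp_summable)
  have sum_plus: "(\<lambda>k. (evol A n o\<^sub>L (id_blinfun - P) o\<^sub>L evol_inv A (k + 1)) (h k))
      summable_on {n..}" if "0 \<le> n" for n
    using summable_on_blinfun_apply[OF summable_on_subset_banach[OF forward_summable[OF P h]],
        of "{n..}" "evol A n"] that
    by (simp add: pulled_forcing_def)
  have sum_minus: "(\<lambda>k. (evol A n o\<^sub>L Q o\<^sub>L evol_inv A (k + 1)) (h k)) summable_on {..n-1}"
    if "n \<le> 0" for n
    using summable_on_blinfun_apply[OF summable_on_subset_banach[OF backward_summable[OF Q h]],
        of "{..n-1}" "evol A n"] that
    by (simp add: pulled_forcing_def)

  have Gp: "G_plus A P Q Dm h n = evol A n (P w - a + accumulated A h n)" if "0 \<le> n" for n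
    using G_plus_eq[OF P h that] by (simp add: bracket w_def a_def)
  have Gm: "G_minus A P Q Dm h n = evol A n (w - Q w + b + accumulated A h n)" if "n \<le> 0" for n
    using G_minus_eq[OF Q h that, of P Dm] unfolding bracket w_def b_def
    by (simp add: blinfun.diff_left)
  have jump: "G_plus A P Q Dm h 0 - G_minus A P Q Dm h 0 = - ?S"
    unfolding S R_apply
    by (simp add: Gp Gm evol_0 accumulated_0 D_apply flip: w_def)

  have S_0: "?S = 0" if sol: "is_solution A h x \<and> bounded (range x)" for x
  proof -
    \<comment> \<open>The two half-axis conditions on \<open>x 0\<close> add up to \<open>D (x 0) = a + b\<close>.\<close>
    have "?D (x 0) = a + b"
      using sol_0[OF sol] by (simp add: D_apply)
    then show ?thesis
      unfolding S R_apply using DDD[of "x 0"] by simp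
  qed

  have main: "{x. is_solution A h x \<and> bounded (range x)} =
          range (\<lambda>c n. (evol A n o\<^sub>L P o\<^sub>L ?N) c + ?G n) \<and>
        is_solution A h ?G \<and> bounded (range ?G)" if "?S = 0"
  proof -
    have Dw: "?D w = a + b"
      using that unfolding S R_apply w_def by simp
    \<comment> \<open>The two branches of \<open>G\<close> have the same initial value, so one formula holds at all times.\<close>
    have glue: "P w - a = w - Q w + b"
      using Dw unfolding D_apply by (simp add: algebra_simps)
    have G: "?G n = evol A n (P w - a + accumulated A h n)" for n
      using Gp[of n] Gm[of n] by (simp add: G_op_def glue)
    then have G0: "?G 0 = P w - a"
      by (simp add: evol_0 accumulated_0)
    have idP: "P (P v) = P v" and idQ: "Q (Q v) = Q v" for v
      by (rule dichotomy_idem[OF P], rule dichotomy_idem[OF Q])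
    have Pa: "P a = 0" and Qb: "Q b = b"
      unfolding a_def b_def
      by (rule projection_forward_load[OF P h], rule projection_backward_load[OF Q h])
    have G_sol: "is_solution A h ?G \<and> bounded (range ?G)"
      unfolding sol_iff
    proof (intro conjI allI)
      show "?G n = evol A n (?G 0 + accumulated A h n)" for n
        unfolding G0 by (rule G)
      show "P (?G 0) = ?G 0 + a"
        by (simp add: G0 blinfun.diff_right idP Pa)
      show "Q (?G 0) = b"
        unfolding G0 glue by (simp add: blinfun.diff_right blinfun.add_right idQ Qb)
    qed
    have "is_solution A h x \<and> bounded (range x) \<longleftrightarrow>
        (\<exists>c. x = (\<lambda>n. (evol A n o\<^sub>L P o\<^sub>L ?N) c + ?G n))" for x
    proof
      assume sol: "is_solution A h x \<and> bounded (range x)"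
      then have x: "x n = evol A n (x 0 + accumulated A h n)" for n
        unfolding sol_iff by iprover
      \<comment> \<open>The difference of two bounded solutions starts in the range of \<open>P\<close> and the kernel of
        \<open>Q\<close>, hence in the kernel of \<open>D\<close>.\<close>
      define c where "c = x 0 - ?G 0"
      have Pc: "P c = c" and Qc: "Q c = 0"
        unfolding c_def by (simp_all add: blinfun.diff_right sol_0[OF sol] sol_0[OF G_sol])
      then have Nc: "?N c = c"
        by (simp add: proj_kernel_def blinfun.diff_left D_apply)
      then have "x n = (evol A n o\<^sub>L P o\<^sub>L ?N) c + ?G n" for n
      proof -
        have "x 0 + accumulated A h n = c + (P w - a + accumulated A h n)"
          by (simp add: c_def G0)
        then show ?thesis
          unfolding x[of n] G by (simp add: Nc Pc blinfun.add_right)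
      qed
      then show "\<exists>c. x = (\<lambda>n. (evol A n o\<^sub>L P o\<^sub>L ?N) c + ?G n)" by blast
    next
      assume "\<exists>c. x = (\<lambda>n. (evol A n o\<^sub>L P o\<^sub>L ?N) c + ?G n)"
      then obtain c where x: "\<And>n. x n = evol A n (P (?N c)) + ?G n" by auto
      have "?D (?N c) = 0"
        using DDD[of c] by (simp add: proj_kernel_def blinfun.diff_left blinfun.diff_right)
      then have PQ: "P (?N c) = ?N c - Q (?N c)"
        unfolding D_apply by (simp add: algebra_simps)
      \<comment> \<open>On the kernel of \<open>D\<close> the operators \<open>P\<close> and \<open>I - Q\<close> agree, so the homogeneous part
        is bounded in both directions.\<close>
      have Q0: "Q (P (?N c)) = 0"
        unfolding PQ by (simp add: blinfun.diff_right idQ)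
      have x0: "x 0 = P (?N c) + ?G 0" by (simp add: x evol_0)
      show "is_solution A h x \<and> bounded (range x)"
        unfolding sol_iff
      proof (intro conjI allI)
        show "x n = evol A n (x 0 + accumulated A h n)" for n
          unfolding x0 G0 unfolding x G by (simp add: blinfun.add_right blinfun.diff_right)
        show "P (x 0) = x 0 + a"
          by (simp add: x0 blinfun.add_right idP sol_0[OF G_sol])
        show "Q (x 0) = b"
          by (simp add: x0 blinfun.add_right Q0 sol_0[OF G_sol])
      qed
    qed
    then show ?thesis using G_sol by auto
  qed
  then have L: "L_op A ?G n = h n" if "?S = 0" for n
    using that by (simp add: is_solution_def L_op_def)
  show ?thesis
    using H_eq H_sum sum_plus sum_minus jump S_0 main L
    by (intro conjI allI impI iffI) auto
qed

end
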